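(* Let $M$ be a connected surface in $E^3$ consisting only of elliptic points (Gauss curvature $K>0$ everywhere), with position vector $x$ and unit normal (Gauss map) $n$. Then $$\Delta^{II}x=-\frac{1}{2K}\,\nabla^{III}(K,n)-2\,n .$$
   Context: $M$ is a connected (sufficiently differentiable) surface in Euclidean 3-space $E^3$ with local coordinates $u^1,u^2$; $/i$ denotes $\partial/\partial u^i$ and repeated indices are summed. The fundamental forms have components $g_{ij}=\langle x_{/i},x_{/j}\rangle$ (form $I$), $b_{ij}=\langle x_{/ij},n\rangle$ (form $II$), $e_{ij}=\langle n_{/i},n_{/j}\rangle$ (form $III$), with inverses $(g^{ij}),(b^{ij}),(e^{ij})$, and $K=\det(b_{ij})/\det(g_{ij})$. The first differential parameter of Beltrami with respect to $III$ is $\nabla^{III}(\varphi,\psi):=e^{ij}\varphi_{/i}\psi_{/j}$, where $\psi$ may be vector-valued (the formula is then taken componentwise). The second differential parameter of Beltrami with respect to $II$ is $\Delta^{II}\varphi:=-b^{ij}\nabla^{II}_i\varphi_{/j}$, where $\nabla^{II}_i$ is the covariant derivative (Levi-Civita connection of $II$) in the $u^i$ direction; it is applied componentwise to vector-valued functions. *)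

theory Defs
  imports "HOL-Analysis.Analysis"
begin

section \<open>Partial derivatives and differentiability classes\<close>

definition pdiff :: "2 \<Rightarrow> (real^2 \<Rightarrow> 'b::real_normed_vector) \<Rightarrow> real^2 \<Rightarrow> 'b" where
  "pdiff i f u = vector_derivative (\<lambda>t. f (u + t *\<^sub>R axis i 1)) (at 0)"

fun C_diff :: "nat \<Rightarrow> (real^2 \<Rightarrow> 'b::real_normed_vector) \<Rightarrow> (real^2) set \<Rightarrow> bool" where
  "C_diff 0 f U \<longleftrightarrow> continuous_on U f"
| "C_diff (Suc k) f U \<longleftrightarrow> f differentiable_on U \<and> (\<forall>i. C_diff k (pdiff i f) U)"


section \<open>Surfaces in Euclidean 3-space\<close>

text \<open>A surface is a topological space \<open>M\<close> with a position map \<open>x\<close> to \<open>E\<^sup>3\<close>, not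
  necessarily injective; an embedded surface is the case \<open>M \<subseteq> E\<^sup>3\<close>, \<open>x = id\<close>. A system of local
  coordinates is given by its inverse \<open>p\<close>, from a coordinate domain \<open>U\<close> onto an open part of
  \<open>M\<close>. Changes of coordinates are then of class \<open>C\<^sup>3\<close>, because \<open>x \<circ> p\<close> is an immersion. The class
  \<open>C\<^sup>3\<close> is the least one for which \<open>K\<close> and the components \<open>b\<^sub>i\<^sub>j\<close> are of class \<open>C\<^sup>1\<close>.\<close>

definition local_coords ::
  "'m::t2_space set \<Rightarrow> ('m \<Rightarrow> real^3) \<Rightarrow> (real^2) set \<Rightarrow> (real^2 \<Rightarrow> 'm) \<Rightarrow> bool" where
  "local_coords M x U p \<longleftrightarrow>
     open U \<and> openin (top_of_set M) (p ` U) \<and> (\<exists>q. homeomorphism U (p ` U) p q) \<and>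
     C_diff 3 (x \<circ> p) U \<and> (\<forall>u\<in>U. inj (frechet_derivative (x \<circ> p) (at u)))"

definition surface :: "'m::t2_space set \<Rightarrow> ('m \<Rightarrow> real^3) \<Rightarrow> bool" where
  "surface M x \<longleftrightarrow> (\<forall>m\<in>M. \<exists>U p. local_coords M x U p \<and> m \<in> p ` U)"

definition unit_normal :: "'m::t2_space set \<Rightarrow> ('m \<Rightarrow> real^3) \<Rightarrow> ('m \<Rightarrow> real^3) \<Rightarrow> bool" where
  "unit_normal M x n \<longleftrightarrow>
     continuous_on M n \<and> (\<forall>m\<in>M. norm (n m) = 1) \<and>
     (\<forall>U p. local_coords M x U p \<longrightarrow> (\<forall>u\<in>U. \<forall>i. n (p u) \<bullet> pdiff i (x \<circ> p) u = 0))"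


section \<open>Fundamental forms and Gauss curvature\<close>

text \<open>In this section \<open>r\<close> and \<open>\<nu>\<close> are the position vector and the unit normal as functions of
  the local coordinates.\<close>

definition form_I :: "(real^2 \<Rightarrow> real^3) \<Rightarrow> real^2 \<Rightarrow> real^2^2" where
  "form_I r u = (\<chi> i j. pdiff i r u \<bullet> pdiff j r u)"

definition form_II :: "(real^2 \<Rightarrow> real^3) \<Rightarrow> (real^2 \<Rightarrow> real^3) \<Rightarrow> real^2 \<Rightarrow> real^2^2" where
  "form_II r \<nu> u = (\<chi> i j. pdiff j (pdiff i r) u \<bullet> \<nu> u)"

definition form_III :: "(real^2 \<Rightarrow> real^3) \<Rightarrow> real^2 \<Rightarrow> real^2^2" where
  "form_III \<nu> u = (\<chi> i j. pdiff i \<nu> u \<bullet> pdiff j \<nu> u)"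

definition gauss_curvature ::
  "(real^2 \<Rightarrow> real^3) \<Rightarrow> (real^2 \<Rightarrow> real^3) \<Rightarrow> real^2 \<Rightarrow> real" where
  "gauss_curvature r \<nu> u = det (form_II r \<nu> u) / det (form_I r u)"

text \<open>The sign of the Gauss curvature does not depend on the coordinates, so on a surface the
  universal quantifier could equally be an existential one.\<close>

definition elliptic_point ::
  "'m::t2_space set \<Rightarrow> ('m \<Rightarrow> real^3) \<Rightarrow> ('m \<Rightarrow> real^3) \<Rightarrow> 'm \<Rightarrow> bool" where
  "elliptic_point M x n m \<longleftrightarrow>
     (\<forall>U p u. local_coords M x U p \<and> u \<in> U \<and> p u = m \<longrightarrow>
        gauss_curvature (x \<circ> p) (n \<circ> p) u > 0)"


section \<open>Differential parameters of Beltrami with respect to a quadratic form\<close>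

text \<open>\<open>G\<close> is a field of nondegenerate symmetric matrices, not necessarily positive definite: for
  \<open>K > 0\<close> the second fundamental form is definite of either sign.\<close>

definition beltrami1 ::
  "(real^2 \<Rightarrow> real^2^2) \<Rightarrow> (real^2 \<Rightarrow> real) \<Rightarrow> (real^2 \<Rightarrow> real) \<Rightarrow> real^2 \<Rightarrow> real" where
  "beltrami1 G \<phi> \<psi> u =
     (\<Sum>i\<in>UNIV. \<Sum>j\<in>UNIV. matrix_inv (G u) $ i $ j * pdiff i \<phi> u * pdiff j \<psi> u)"

definition christoffel :: "(real^2 \<Rightarrow> real^2^2) \<Rightarrow> 2 \<Rightarrow> 2 \<Rightarrow> 2 \<Rightarrow> real^2 \<Rightarrow> real" where
  "christoffel G k i j u =
     (1 / 2) * (\<Sum>l\<in>UNIV. matrix_inv (G u) $ k $ l *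
        (pdiff i (\<lambda>v. G v $ j $ l) u + pdiff j (\<lambda>v. G v $ i $ l) u
          - pdiff l (\<lambda>v. G v $ i $ j) u))"

text \<open>Component \<open>j\<close> of the covariant derivative, in the direction \<open>i\<close>, of the covector field
  with components \<open>\<omega> 1, \<omega> 2\<close>.\<close>

definition cov_deriv ::
  "(real^2 \<Rightarrow> real^2^2) \<Rightarrow> 2 \<Rightarrow> (2 \<Rightarrow> real^2 \<Rightarrow> real) \<Rightarrow> 2 \<Rightarrow> real^2 \<Rightarrow> real" where
  "cov_deriv G i \<omega> j u = pdiff i (\<omega> j) u - (\<Sum>k\<in>UNIV. christoffel G k i j u * \<omega> k u)"

definition beltrami2 :: "(real^2 \<Rightarrow> real^2^2) \<Rightarrow> (real^2 \<Rightarrow> real) \<Rightarrow> real^2 \<Rightarrow> real" where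
  "beltrami2 G \<phi> u =
     - (\<Sum>i\<in>UNIV. \<Sum>j\<in>UNIV. matrix_inv (G u) $ i $ j * cov_deriv G i (\<lambda>k. pdiff k \<phi>) j u)"

definition beltrami1_vec ::
  "(real^2 \<Rightarrow> real^2^2) \<Rightarrow> (real^2 \<Rightarrow> real) \<Rightarrow> (real^2 \<Rightarrow> real^3) \<Rightarrow> real^2 \<Rightarrow> real^3" where
  "beltrami1_vec G \<phi> \<psi> u = (\<chi> a. beltrami1 G \<phi> (\<lambda>v. \<psi> v $ a) u)"

definition beltrami2_vec :: "(real^2 \<Rightarrow> real^2^2) \<Rightarrow> (real^2 \<Rightarrow> real^3) \<Rightarrow> real^2 \<Rightarrow> real^3" where
  "beltrami2_vec G \<phi> u = (\<chi> a. beltrami2 G (\<lambda>v. \<phi> v $ a) u)"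

end

theory Submission
  imports Defs
begin

text \<open>Let \<open>w\<close> be the difference of the two sides. Since \<open>det II \<noteq> 0\<close>, the vectors \<open>n\<^sub>/\<^sub>1, n\<^sub>/\<^sub>2, n\<close> form
  a frame, so it suffices that \<open>w\<close> is orthogonal to them. For \<open>n\<close> this is the trace
  \<open>b\<^sup>i\<^sup>j b\<^sub>i\<^sub>j = 2\<close>. For \<open>n\<^sub>/\<^sub>m\<close>, the Weingarten relation \<open>\<langle>x\<^sub>/\<^sub>k, n\<^sub>/\<^sub>m\<rangle> = - b\<^sub>k\<^sub>m\<close> lowers the index of the
  Christoffel symbols of \<open>II\<close>, which leaves the logarithmic derivatives \<open>b\<^sup>i\<^sup>j b\<^sub>i\<^sub>j\<^sub>/\<^sub>m\<close> of \<open>det II\<close>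
  and, because \<open>b\<^sup>i\<^sup>j n\<^sub>/\<^sub>i = - g\<^sup>j\<^sup>l x\<^sub>/\<^sub>l\<close>, \<open>g\<^sup>j\<^sup>l g\<^sub>j\<^sub>l\<^sub>/\<^sub>m\<close> of \<open>det I\<close>; their difference is
  \<open>K\<^sub>/\<^sub>m / K\<close>.\<close>

unbundle cross3_syntax

section \<open>Partial derivatives\<close>

text \<open>Chain rule along a coordinate line. The parameter \<open>t\<close> is arbitrary, not
  only 0, because the mean value theorem below needs the derivative along a whole segment.\<close>

lemma pdiff_line:
  fixes f :: "real^2 \<Rightarrow> 'a::real_normed_vector"
  assumes "(f has_derivative D) (at (u + t *\<^sub>R axis i 1))"
  shows "((\<lambda>s. f (u + s *\<^sub>R axis i 1)) has_vector_derivative D (axis i 1)) (at t)"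
proof -
  have "((\<lambda>s. u + s *\<^sub>R axis i (1::real)) has_derivative (\<lambda>s. s *\<^sub>R axis i 1)) (at t)"
    by (auto intro!: derivative_eq_intros)
  from diff_chain_at[OF this assms] show ?thesis
    using linear_scale[OF has_derivative_linear[OF assms]]
    by (simp add: has_vector_derivative_def o_def)
qed

lemma pdiff_eq:
  assumes "(f has_derivative D) (at u)"
  shows "pdiff i f u = D (axis i 1)"
  using pdiff_line[of f D u 0 i] assms unfolding pdiff_def
  by (intro vector_derivative_at) simp

lemma pdiff_line_differentiable:
  assumes "f differentiable (at (u + t *\<^sub>R axis i 1))"
  shows "((\<lambda>s. f (u + s *\<^sub>R axis i 1)) has_vector_derivative pdiff i f (u + t *\<^sub>R axis i 1)) (at t)"
  using assms pdiff_line pdiff_eq unfolding differentiable_def by metis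

text \<open>Agreement on an open set transfers the derivative of \<open>f\<close> to
  \<open>g\<close>. This is how identities that hold only on a coordinate domain get
  differentiated.\<close>

lemma pdiff_cong:
  assumes "f differentiable (at u)" "open U" "u \<in> U" "\<And>v. v \<in> U \<Longrightarrow> f v = g v"
  shows "pdiff i f u = pdiff i g u"
  using assms has_derivative_transform_within_open[of f _ u UNIV U g] pdiff_eq
  unfolding differentiable_def by metis

lemma pdiff_bounded_linear:
  assumes "bounded_linear L" "f differentiable (at u)"
  shows "pdiff i (\<lambda>v. L (f v)) u = L (pdiff i f u)"
  using assms bounded_linear.has_derivative pdiff_eq unfolding differentiable_def by metis

lemma pdiff_bilinear:
  assumes "bounded_bilinear h" "f differentiable (at u)" "g differentiable (at u)"
  shows "pdiff i (\<lambda>v. h (f v) (g v)) u = h (f u) (pdiff i g u) + h (pdiff i f u) (g u)"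
proof -
  obtain F G where FG: "(f has_derivative F) (at u)" "(g has_derivative G) (at u)"
    using assms(2,3) unfolding differentiable_def by blast
  show ?thesis
    using pdiff_eq[OF bounded_bilinear.FDERIV[OF assms(1) FG]] FG[THEN pdiff_eq] by simp
qed

lemmas pdiff_inner = pdiff_bilinear[OF bounded_bilinear_inner]
lemmas pdiff_mult = pdiff_bilinear[OF bounded_bilinear_mult]

lemma pdiff_diff:
  assumes "f differentiable (at u)" "g differentiable (at u)"
  shows "pdiff i (\<lambda>v. f v - g v) u = pdiff i f u - pdiff i g u"
proof -
  obtain F G where FG: "(f has_derivative F) (at u)" "(g has_derivative G) (at u)"
    using assms unfolding differentiable_def by blast
  show ?thesis
    using pdiff_eq[OF has_derivative_diff[OF FG]] FG[THEN pdiff_eq] by simp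
qed

lemma pdiff_const: "pdiff i (\<lambda>v. c) u = 0"
  using pdiff_eq[OF has_derivative_const] by blast

section \<open>Differentiability classes\<close>

lemma C_diff_Suc_at:
  assumes "C_diff (Suc k) f U" "open U" "u \<in> U"
  shows "f differentiable (at u)"
  using assms differentiable_on_eq_differentiable_at by auto

lemma C_diff_continuous_on: "C_diff k f U \<Longrightarrow> continuous_on U f"
  by (cases k) (auto intro: differentiable_imp_continuous_on)

text \<open>The function \<open>g\<close> is any function agreeing with \<open>L (f v)\<close> on
  \<open>U\<close>: the partial derivatives satisfy \<open>pdiff i g v = L (pdiff i f v)\<close> on
  \<open>U\<close> only, so the induction hypothesis must allow arbitrary values outside.\<close>

lemma C_diff_bounded_linear:
  assumes "open U" "bounded_linear L"
  shows "C_diff k f U \<Longrightarrow> (\<And>v. v \<in> U \<Longrightarrow> g v = L (f v)) \<Longrightarrow> C_diff k g U"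
proof (induction k arbitrary: f g)
  case 0
  then show ?case
    using bounded_linear.continuous_on[OF assms(2)] by (auto cong: continuous_on_cong)
next
  case (Suc k)
  have f: "f differentiable (at v)" if "v \<in> U" for v
    using C_diff_Suc_at[OF Suc.prems(1) assms(1) that] .
  have Lf: "(\<lambda>v. L (f v)) differentiable (at v)" if "v \<in> U" for v
    using f[OF that] bounded_linear.has_derivative[OF assms(2)]
    unfolding differentiable_def by blast
  have "g differentiable (at v)" if "v \<in> U" for v
    using Lf[OF that] Suc.prems(2) assms(1) that
      has_derivative_transform_within_open[of "\<lambda>v. L (f v)" _ v UNIV U g]
    unfolding differentiable_def by metis
  moreover have "pdiff i g v = L (pdiff i f v)" if "v \<in> U" for i v
    using pdiff_cong[OF Lf[OF that] assms(1) that, of g] Suc.prems(2) 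
      pdiff_bounded_linear[OF assms(2) f[OF that]] by metis
  ultimately show ?case
    using Suc.IH[of "pdiff _ f" "pdiff _ g"] Suc.prems(1)
    by (auto simp: differentiable_at_imp_differentiable_on)
qed

section \<open>Symmetry of second partial derivatives\<close>

lemma second_difference_mvt:
  fixes f :: "real^2 \<Rightarrow> real"
  assumes "0 < h"
    and f: "\<And>s t. 0 \<le> s \<Longrightarrow> s \<le> h \<Longrightarrow> 0 \<le> t \<Longrightarrow> t \<le> h \<Longrightarrow>
      f differentiable (at (u + s *\<^sub>R axis i 1 + t *\<^sub>R axis j 1))"
    and f': "\<And>s t. 0 \<le> s \<Longrightarrow> s \<le> h \<Longrightarrow> 0 \<le> t \<Longrightarrow> t \<le> h \<Longrightarrow>
      pdiff i f differentiable (at (u + s *\<^sub>R axis i 1 + t *\<^sub>R axis j 1))"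
  obtains s t where "0 < s" "s < h" "0 < t" "t < h"
    "f (u + h *\<^sub>R axis i 1 + h *\<^sub>R axis j 1) - f (u + h *\<^sub>R axis i 1)
      - f (u + h *\<^sub>R axis j 1) + f u
      = h * h * pdiff j (pdiff i f) (u + s *\<^sub>R axis i 1 + t *\<^sub>R axis j 1)"
proof -
  \<comment> \<open>The second difference is \<open>?g h - ?g 0\<close>. One mean value theorem in
    direction \<open>i\<close> produces \<open>s\<close>, a second one in direction
    \<open>j\<close>, applied to \<open>pdiff i f\<close>, produces \<open>t\<close>.\<close>
  let ?g = "\<lambda>s. f (u + h *\<^sub>R axis j 1 + s *\<^sub>R axis i 1) - f (u + s *\<^sub>R axis i 1)"
  let ?g' = "\<lambda>s. pdiff i f (u + h *\<^sub>R axis j 1 + s *\<^sub>R axis i 1) - pdiff i f (u + s *\<^sub>R axis i 1)"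
  have "(?g has_real_derivative ?g' s) (at s)" if "0 \<le> s" "s \<le> h" for s
    using pdiff_line_differentiable[of f "u + h *\<^sub>R axis j 1" s i]
      pdiff_line_differentiable[of f u s i] f[OF that, of h] f[OF that, of 0] \<open>0 < h\<close>
    by (intro DERIV_diff)
      (simp_all add: has_real_derivative_iff_has_vector_derivative ac_simps)
  from MVT2[OF \<open>0 < h\<close>, of ?g, OF this]
  obtain s where s: "0 < s" "s < h" "?g h - ?g 0 = h * ?g' s" by auto
  let ?k = "\<lambda>t. pdiff i f (u + s *\<^sub>R axis i 1 + t *\<^sub>R axis j 1)"
  have "(?k has_real_derivative pdiff j (pdiff i f) (u + s *\<^sub>R axis i 1 + t *\<^sub>R axis j 1)) (at t)"
    if "0 \<le> t" "t \<le> h" for t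
    using pdiff_line_differentiable[of "pdiff i f" "u + s *\<^sub>R axis i 1" t j] f'[of s t] s that
    by (simp add: has_real_derivative_iff_has_vector_derivative)
  from MVT2[OF \<open>0 < h\<close>, of ?k, OF this]
  obtain t where "0 < t" "t < h"
    "?k h - ?k 0 = h * pdiff j (pdiff i f) (u + s *\<^sub>R axis i 1 + t *\<^sub>R axis j 1)" by auto
  with s show thesis
    by (intro that[of s t]) (simp_all add: ac_simps)
qed

text \<open>The second difference is symmetric in the two directions, so both mixed derivatives take
  a common value at points arbitrarily close to \<open>u\<close>; their continuity then forces
  equality at \<open>u\<close>.\<close>

lemma pdiff_commute_real:
  fixes f :: "real^2 \<Rightarrow> real"
  assumes f: "C_diff 2 f U" and U: "open U" "u \<in> U"
  shows "pdiff i (pdiff j f) u = pdiff j (pdiff i f) u"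
proof (rule ccontr)
  assume ne: "pdiff i (pdiff j f) u \<noteq> pdiff j (pdiff i f) u"
  \<comment> \<open>Half the gap: no number is closer than \<open>e\<close> to both mixed
    derivatives.\<close>
  define e where "e = dist (pdiff i (pdiff j f) u) (pdiff j (pdiff i f) u) / 2"
  have e: "0 < e" using ne by (simp add: e_def)
  have f2: "C_diff (Suc (Suc 0)) f U" using f by (simp add: numeral_2_eq_2)
  have cont: "continuous (at u) (pdiff k (pdiff l f))" for k l
    using f2 U continuous_on_eq_continuous_at by auto
  have near: "\<exists>d>0. \<forall>v. dist v u < d \<longrightarrow> dist (pdiff k (pdiff l f) v) (pdiff k (pdiff l f) u) < e" for k l
    using cont[of k l] e unfolding continuous_at_eps_delta by auto
  obtain d1 where d1: "0 < d1"
    "\<And>v. dist v u < d1 \<Longrightarrow> dist (pdiff i (pdiff j f) v) (pdiff i (pdiff j f) u) < e"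
    using near[of i j] by auto
  obtain d2 where d2: "0 < d2"
    "\<And>v. dist v u < d2 \<Longrightarrow> dist (pdiff j (pdiff i f) v) (pdiff j (pdiff i f) u) < e"
    using near[of j i] by auto
  obtain d3 where d3: "0 < d3" "ball u d3 \<subseteq> U" using U open_contains_ball by blast
  \<comment> \<open>Points of the square of side \<open>h\<close> are at distance at most
    \<open>2 * h\<close> from \<open>u\<close>, so a third of the smallest radius suffices.\<close>
  define h where "h = min d1 (min d2 d3) / 3"
  have h: "0 < h" "2 * h < d1" "2 * h < d2" "2 * h < d3" using d1(1) d2(1) d3(1) by (auto simp: h_def)
  have close: "dist (u + s *\<^sub>R axis k 1 + t *\<^sub>R axis l 1) u \<le> 2 * h"
    if "0 \<le> s" "s \<le> h" "0 \<le> t" "t \<le> h" for s t and k l :: 2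
    using norm_triangle_ineq[of "s *\<^sub>R axis k (1::real)" "t *\<^sub>R axis l 1"] that
    by (simp add: dist_norm norm_axis_1 add.assoc)
  have inU: "u + s *\<^sub>R axis k 1 + t *\<^sub>R axis l 1 \<in> U"
    if "0 \<le> s" "s \<le> h" "0 \<le> t" "t \<le> h" for s t and k l :: 2
    using close[OF that, of k l] h d3 by (auto simp: dist_commute)
  have diff: "f differentiable (at v)" "pdiff k f differentiable (at v)" if "v \<in> U" for v k
    using f2 U(1) that C_diff_Suc_at by (blast, metis C_diff.simps(2) C_diff_Suc_at)
  have mvt: "\<exists>s t. 0 < s \<and> s < h \<and> 0 < t \<and> t < h \<and>
    f (u + h *\<^sub>R axis k 1 + h *\<^sub>R axis l 1) - f (u + h *\<^sub>R axis k 1)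
      - f (u + h *\<^sub>R axis l 1) + f u
      = h * h * pdiff l (pdiff k f) (u + s *\<^sub>R axis k 1 + t *\<^sub>R axis l 1)" for k l
    by (rule second_difference_mvt[of h f u k l, OF h(1)]) (simp_all add: diff inU, blast)
  obtain s t where st: "0 < s" "s < h" "0 < t" "t < h"
    "f (u + h *\<^sub>R axis i 1 + h *\<^sub>R axis j 1) - f (u + h *\<^sub>R axis i 1)
      - f (u + h *\<^sub>R axis j 1) + f u
      = h * h * pdiff j (pdiff i f) (u + s *\<^sub>R axis i 1 + t *\<^sub>R axis j 1)"
    using mvt[of i j] by auto
  obtain s' t' where st': "0 < s'" "s' < h" "0 < t'" "t' < h"
    "f (u + h *\<^sub>R axis j 1 + h *\<^sub>R axis i 1) - f (u + h *\<^sub>R axis j 1)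
      - f (u + h *\<^sub>R axis i 1) + f u
      = h * h * pdiff i (pdiff j f) (u + s' *\<^sub>R axis j 1 + t' *\<^sub>R axis i 1)"
    using mvt[of j i] by auto
  \<comment> \<open>The far corner is the same in either order, so both mean value statements
    evaluate one second difference.\<close>
  have swap: "u + h *\<^sub>R axis j 1 + h *\<^sub>R axis i 1 = u + h *\<^sub>R axis i 1 + h *\<^sub>R axis j 1"
    by (simp only: ac_simps)
  have "h * h * pdiff i (pdiff j f) (u + s' *\<^sub>R axis j 1 + t' *\<^sub>R axis i 1)
      = h * h * pdiff j (pdiff i f) (u + s *\<^sub>R axis i 1 + t *\<^sub>R axis j 1)"
    using st(5) st'(5)[unfolded swap] by linarith
  then have "pdiff i (pdiff j f) (u + s' *\<^sub>R axis j 1 + t' *\<^sub>R axis i 1)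
      = pdiff j (pdiff i f) (u + s *\<^sub>R axis i 1 + t *\<^sub>R axis j 1)"
    using h by simp
  moreover have "dist (pdiff i (pdiff j f) (u + s' *\<^sub>R axis j 1 + t' *\<^sub>R axis i 1))
      (pdiff i (pdiff j f) u) < e"
    using d1(2) close[of s' t' j i] st' h by force
  moreover have "dist (pdiff j (pdiff i f) (u + s *\<^sub>R axis i 1 + t *\<^sub>R axis j 1))
      (pdiff j (pdiff i f) u) < e"
    using d2(2) close[of s t i j] st h by force
  ultimately show False
    unfolding e_def dist_real_def by (auto simp: abs_if split: if_splits)
qed

text \<open>The mean value argument is scalar, so it is applied to the inner product of
  \<open>f\<close> with each fixed vector \<open>w\<close>.\<close>

lemma pdiff_commute:
  fixes f :: "real^2 \<Rightarrow> 'a::real_inner"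
  assumes f: "C_diff 2 f U" and U: "open U" "u \<in> U"
  shows "pdiff i (pdiff j f) u = pdiff j (pdiff i f) u"
proof -
  have f2: "C_diff (Suc (Suc 0)) f U" using f by (simp add: numeral_2_eq_2)
  have diff: "f differentiable (at v)" "pdiff k f differentiable (at v)" if "v \<in> U" for v k
    using f2 U(1) that C_diff_Suc_at by (blast, metis C_diff.simps(2) C_diff_Suc_at)
  have "pdiff k (pdiff l (\<lambda>v. f v \<bullet> w)) u = pdiff k (pdiff l f) u \<bullet> w" for k l w
  proof -
    have "pdiff l f v \<bullet> w = pdiff l (\<lambda>v. f v \<bullet> w) v" if "v \<in> U" for v
      using pdiff_bounded_linear[OF bounded_linear_inner_left diff(1)[OF that]] by metis
    then have "pdiff k (\<lambda>v. pdiff l f v \<bullet> w) u = pdiff k (pdiff l (\<lambda>v. f v \<bullet> w)) u"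
      by (intro pdiff_cong[of _ u U]) (simp_all add: U diff)
    then show ?thesis
      using pdiff_bounded_linear[OF bounded_linear_inner_left diff(2)[OF U(2)]] by metis
  qed
  moreover have "C_diff 2 (\<lambda>v. f v \<bullet> w) U" for w
    using C_diff_bounded_linear[OF U(1) bounded_linear_inner_left f, of "\<lambda>v. f v \<bullet> w" w] by simp
  ultimately have "pdiff i (pdiff j f) u \<bullet> w = pdiff j (pdiff i f) u \<bullet> w" for w
    using pdiff_commute_real U by metis
  then show ?thesis using vector_eq_rdot by blast
qed


lemma C_diff_Suc_imp: "C_diff (Suc k) f U \<Longrightarrow> C_diff k f U"
proof (induction k arbitrary: f)
  case 0
  then show ?case by (auto intro: differentiable_imp_continuous_on)
next
  case (Suc k)
  then show ?case by (metis C_diff.simps(2))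
qed


section \<open>Linear algebra\<close>

text \<open>The Binet-Cauchy identity. It turns 2 by 2 determinants of inner products into products
  of normals.\<close>

lemma cross_dot_cross:
  "(a \<times> b) \<bullet> (c \<times> d) = (a \<bullet> c) * (b \<bullet> d) - (a \<bullet> d) * (b \<bullet> c)" for a b c d :: "real^3"
  by (simp add: cross3_simps)

text \<open>Being orthogonal to \<open>a\<close> and \<open>b\<close>, both \<open>c\<close> and
  \<open>v\<close> are parallel to the cross product of \<open>a\<close> and \<open>b\<close>. Hence
  \<open>v\<close>, orthogonal to \<open>c\<close>, is also orthogonal to that product, and a vector
  both parallel and orthogonal to a nonzero vector is 0.\<close>

lemma eq_0_if_orthogonal_to_frame:
  fixes a b c v :: "real^3"
  assumes "a \<times> b \<noteq> 0" "c \<noteq> 0" and c: "c \<bullet> a = 0" "c \<bullet> b = 0"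
    and v: "v \<bullet> a = 0" "v \<bullet> b = 0" "v \<bullet> c = 0"
  shows "v = 0"
proof -
  let ?N = "a \<times> b"
  have "c \<times> ?N = 0" "v \<times> ?N = 0" using c v by (simp_all add: Lagrange)
  then have "(c \<bullet> ?N) *\<^sub>R c = (c \<bullet> c) *\<^sub>R ?N" using Lagrange[of c c ?N] by simp
  then have "(c \<bullet> ?N) * (v \<bullet> c) = (c \<bullet> c) * (v \<bullet> ?N)" by (metis inner_scaleR_right)
  then have "v \<bullet> ?N = 0" using v assms(2) by simp
  then have "(?N \<bullet> ?N) *\<^sub>R v = 0"
    using \<open>v \<times> ?N = 0\<close> Lagrange[of ?N v ?N] by (simp add: inner_commute)
  then show ?thesis using assms(1) by simp
qed

lemma matrix_inv_mult:
  fixes A :: "real^'n^'n"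
  assumes "det A \<noteq> 0"
  shows "(\<Sum>k\<in>UNIV. A $ i $ k * matrix_inv A $ k $ j) = (if i = j then 1 else 0)"
    and "(\<Sum>k\<in>UNIV. matrix_inv A $ i $ k * A $ k $ j) = (if i = j then 1 else 0)"
proof -
  have "invertible A" using assms invertible_det_nz by blast
  \<comment> \<open>\<open>matrix_inv\<close> is a Hilbert choice, so existence of an inverse yields
    its two equations.\<close>
  then have "A ** matrix_inv A = mat 1 \<and> matrix_inv A ** A = mat 1"
    unfolding invertible_def matrix_inv_def by (rule someI_ex)
  then show "(\<Sum>k\<in>UNIV. A $ i $ k * matrix_inv A $ k $ j) = (if i = j then 1 else 0)"
    and "(\<Sum>k\<in>UNIV. matrix_inv A $ i $ k * A $ k $ j) = (if i = j then 1 else 0)"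
    by (simp_all add: matrix_matrix_mult_def mat_def vec_eq_iff)
qed

text \<open>Cramer's rule, from the four scalar equations of
  \<open>A ** matrix_inv A = mat 1\<close>.\<close>

lemma matrix_inv_2:
  fixes A :: "real^2^2"
  assumes "det A \<noteq> 0"
  shows "matrix_inv A $ 1 $ 1 = A $ 2 $ 2 / det A" "matrix_inv A $ 1 $ 2 = - A $ 1 $ 2 / det A"
    "matrix_inv A $ 2 $ 1 = - A $ 2 $ 1 / det A" "matrix_inv A $ 2 $ 2 = A $ 1 $ 1 / det A"
proof -
  define X where "X = matrix_inv A"
  have X: "A $ 1 $ 1 * X $ 1 $ 1 + A $ 1 $ 2 * X $ 2 $ 1 = 1"
    "A $ 1 $ 1 * X $ 1 $ 2 + A $ 1 $ 2 * X $ 2 $ 2 = 0"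
    "A $ 2 $ 1 * X $ 1 $ 1 + A $ 2 $ 2 * X $ 2 $ 1 = 0"
    "A $ 2 $ 1 * X $ 1 $ 2 + A $ 2 $ 2 * X $ 2 $ 2 = 1"
    using matrix_inv_mult(1)[OF assms, of 1 1] matrix_inv_mult(1)[OF assms, of 1 2]
      matrix_inv_mult(1)[OF assms, of 2 1] matrix_inv_mult(1)[OF assms, of 2 2]
    by (simp_all add: sum_2 X_def)
  have "X $ 1 $ 1 * det A = A $ 2 $ 2" "X $ 1 $ 2 * det A = - A $ 1 $ 2"
    "X $ 2 $ 1 * det A = - A $ 2 $ 1" "X $ 2 $ 2 * det A = A $ 1 $ 1"
    unfolding det_2 using X by algebra+
  then show "matrix_inv A $ 1 $ 1 = A $ 2 $ 2 / det A" "matrix_inv A $ 1 $ 2 = - A $ 1 $ 2 / det A"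
    "matrix_inv A $ 2 $ 1 = - A $ 2 $ 1 / det A" "matrix_inv A $ 2 $ 2 = A $ 1 $ 1 / det A"
    using assms by (simp_all only: X_def nonzero_eq_divide_eq not_False_eq_True)
qed

lemma matrix_inv_sym_2:
  fixes A :: "real^2^2"
  assumes "det A \<noteq> 0" "A $ 1 $ 2 = A $ 2 $ 1"
  shows "matrix_inv A $ 1 $ 2 = matrix_inv A $ 2 $ 1"
  using assms by (simp add: matrix_inv_2)

text \<open>Jacobi's formula for the derivative of a determinant, in the 2 by 2 case.\<close>

lemma pdiff_det:
  fixes A :: "real^2 \<Rightarrow> real^2^2"
  assumes "det (A u) \<noteq> 0" "\<And>i j. (\<lambda>v. A v $ i $ j) differentiable (at u)"
  shows "(\<lambda>v. det (A v)) differentiable (at u)"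
    and "pdiff m (\<lambda>v. det (A v)) u = det (A u) *
      (\<Sum>i\<in>UNIV. \<Sum>j\<in>UNIV. matrix_inv (A u) $ j $ i * pdiff m (\<lambda>v. A v $ i $ j) u)"
proof -
  show "(\<lambda>v. det (A v)) differentiable (at u)"
    unfolding det_2 by (intro differentiable_diff differentiable_mult assms)
  show "pdiff m (\<lambda>v. det (A v)) u = det (A u) *
      (\<Sum>i\<in>UNIV. \<Sum>j\<in>UNIV. matrix_inv (A u) $ j $ i * pdiff m (\<lambda>v. A v $ i $ j) u)"
  proof -
    have "pdiff m (\<lambda>v. det (A v)) u =
        A u $ 1 $ 1 * pdiff m (\<lambda>v. A v $ 2 $ 2) u + pdiff m (\<lambda>v. A v $ 1 $ 1) u * A u $ 2 $ 2
        - (A u $ 1 $ 2 * pdiff m (\<lambda>v. A v $ 2 $ 1) u + pdiff m (\<lambda>v. A v $ 1 $ 2) u * A u $ 2 $ 1)"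
      unfolding det_2 by (simp add: pdiff_diff pdiff_mult assms(2))
    then show ?thesis
      using assms(1) by (simp add: sum_2 matrix_inv_2 divide_simps)
  qed
qed

text \<open>Contraction with \<open>G\<close> cancels the inverse matrix and leaves the Christoffel
  symbols of the first kind.\<close>

lemma christoffel_lowered:
  assumes "det (G u) \<noteq> 0"
  shows "(\<Sum>k\<in>UNIV. G u $ m $ k * christoffel G k i j u) =
    (1 / 2) * (pdiff i (\<lambda>v. G v $ j $ m) u + pdiff j (\<lambda>v. G v $ i $ m) u
      - pdiff m (\<lambda>v. G v $ i $ j) u)"
proof -
  define T where "T l = pdiff i (\<lambda>v. G v $ j $ l) u + pdiff j (\<lambda>v. G v $ i $ l) u
      - pdiff l (\<lambda>v. G v $ i $ j) u" for l
  have "(\<Sum>k\<in>UNIV. G u $ m $ k * christoffel G k i j u)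
      = (1 / 2) * (\<Sum>k\<in>UNIV. \<Sum>l\<in>UNIV. G u $ m $ k * matrix_inv (G u) $ k $ l * T l)"
    by (simp add: christoffel_def T_def[symmetric] sum_distrib_left mult_ac)
  also have "\<dots> = (1 / 2) * (\<Sum>l\<in>UNIV. (\<Sum>k\<in>UNIV. G u $ m $ k * matrix_inv (G u) $ k $ l) * T l)"
    by (subst sum.swap) (simp add: sum_distrib_right)
  also have "\<dots> = (1 / 2) * T m"
    by (simp add: matrix_inv_mult(1)[OF assms] if_distrib[of "\<lambda>x. x * _"] cong: if_cong)
  finally show ?thesis by (simp add: T_def)
qed


section \<open>Vector-valued Beltrami parameters\<close>

lemma beltrami1_vec_eq:
  assumes "\<psi> differentiable (at u)"
  shows "beltrami1_vec G \<phi> \<psi> u =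
    (\<Sum>i\<in>UNIV. \<Sum>j\<in>UNIV. (matrix_inv (G u) $ i $ j * pdiff i \<phi> u) *\<^sub>R pdiff j \<psi> u)"
  using pdiff_bounded_linear[OF bounded_linear_vec_nth assms]
  by (simp add: beltrami1_vec_def beltrami1_def vec_eq_iff)

text \<open>Projection to a component commutes with derivatives. For the inner derivative this is
  needed on all of \<open>U\<close>, since it is differentiated once more.\<close>

lemma beltrami2_vec_eq:
  assumes "C_diff 2 \<phi> U" "open U" "u \<in> U"
  shows "beltrami2_vec G \<phi> u =
    - (\<Sum>i\<in>UNIV. \<Sum>j\<in>UNIV. matrix_inv (G u) $ i $ j *\<^sub>R
        (pdiff i (pdiff j \<phi>) u - (\<Sum>k\<in>UNIV. christoffel G k i j u *\<^sub>R pdiff k \<phi> u)))"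
proof -
  have "C_diff (Suc (Suc 0)) \<phi> U" using assms(1) by (simp add: numeral_2_eq_2)
  then have diff: "\<phi> differentiable (at v)" "pdiff k \<phi> differentiable (at v)" if "v \<in> U" for v k
    using assms(2) that C_diff_Suc_at by (blast, metis C_diff.simps(2) C_diff_Suc_at)
  have 1: "pdiff k (\<lambda>v. \<phi> v $ a) v = pdiff k \<phi> v $ a" if "v \<in> U" for k a v
    using pdiff_bounded_linear[OF bounded_linear_vec_nth diff(1)[OF that]] .
  have 2: "pdiff i (pdiff j (\<lambda>v. \<phi> v $ a)) u = pdiff i (pdiff j \<phi>) u $ a" for i j a
  proof -
    have "(\<lambda>v. pdiff j \<phi> v $ a) differentiable (at u)"
      using diff(2)[OF assms(3), of j] bounded_linear.has_derivative[OF bounded_linear_vec_nth]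
      unfolding differentiable_def by blast
    then have "pdiff i (\<lambda>v. pdiff j \<phi> v $ a) u = pdiff i (pdiff j (\<lambda>v. \<phi> v $ a)) u"
      by (rule pdiff_cong[OF _ assms(2,3)]) (simp add: 1)
    then show ?thesis
      using pdiff_bounded_linear[OF bounded_linear_vec_nth diff(2)[OF assms(3)]] by metis
  qed
  show ?thesis
    by (simp add: vec_eq_iff beltrami2_vec_def beltrami2_def cov_deriv_def 1[OF assms(3)] 2)
qed


section \<open>Patches with nondegenerate second fundamental form\<close>

text \<open>The computation takes place in one coordinate domain. Differentiability of
  \<open>\<nu>\<close> is assumed here; for the normal of a surface it is derived from continuity in
  the last section.\<close>

context
  fixes U :: "(real^2) set" and r \<nu> :: "real^2 \<Rightarrow> real^3"
  assumes open_U: "open U"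
    and r_C3: "C_diff 3 r U"
    and \<nu>_differentiable: "v \<in> U \<Longrightarrow> \<nu> differentiable (at v)"
    and norm_\<nu>: "v \<in> U \<Longrightarrow> norm (\<nu> v) = 1"
    and \<nu>_tangent: "v \<in> U \<Longrightarrow> \<nu> v \<bullet> pdiff i r v = 0"
    and det_I: "v \<in> U \<Longrightarrow> det (form_I r v) \<noteq> 0"
    and det_II: "v \<in> U \<Longrightarrow> det (form_II r \<nu> v) \<noteq> 0"
begin

section \<open>Derivatives of the position vector\<close>

lemma r_C_diff: "C_diff 2 r U" "C_diff 2 (pdiff i r) U" "C_diff (Suc 0) (pdiff i (pdiff j r)) U"
proof -
  have 3: "C_diff (Suc (Suc (Suc 0))) r U"
    using r_C3 by (simp only: numeral_3_eq_3)
  then show "C_diff 2 r U" "C_diff 2 (pdiff i r) U" "C_diff (Suc 0) (pdiff i (pdiff j r)) U"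
    using C_diff_Suc_imp[OF 3] by (simp_all add: numeral_2_eq_2)
qed

lemma r_differentiable:
  assumes "v \<in> U"
  shows "r differentiable (at v)" "pdiff i r differentiable (at v)"
    "pdiff i (pdiff j r) differentiable (at v)"
  using C_diff_Suc_at[OF _ open_U assms] r_C_diff by (metis numeral_2_eq_2)+

lemma pdiff2_commute: "v \<in> U \<Longrightarrow> pdiff i (pdiff j r) v = pdiff j (pdiff i r) v"
  using pdiff_commute[OF r_C_diff(1) open_U] .

text \<open>The first swap is the symmetry for \<open>pdiff k r\<close>; the second differentiates
  the symmetry for \<open>r\<close>, which holds throughout \<open>U\<close>.\<close>

lemma pdiff3_commute:
  assumes "v \<in> U"
  shows "pdiff i (pdiff j (pdiff k r)) v = pdiff j (pdiff i (pdiff k r)) v"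
    and "pdiff i (pdiff j (pdiff k r)) v = pdiff i (pdiff k (pdiff j r)) v"
  using pdiff_commute[OF r_C_diff(2) open_U assms]
    pdiff_cong[OF r_differentiable(3)[OF assms] open_U assms] pdiff2_commute by blast+

lemma form_I_component: "form_I r v $ i $ j = pdiff i r v \<bullet> pdiff j r v"
  and form_II_component: "form_II r \<nu> v $ i $ j = pdiff j (pdiff i r) v \<bullet> \<nu> v"
  and form_III_component: "form_III \<nu> v $ i $ j = pdiff i \<nu> v \<bullet> pdiff j \<nu> v"
  by (simp_all add: form_I_def form_II_def form_III_def)

lemma form_I_sym: "form_I r v $ i $ j = form_I r v $ j $ i"
  by (simp add: form_I_component inner_commute)

lemma form_II_sym: "v \<in> U \<Longrightarrow> form_II r \<nu> v $ i $ j = form_II r \<nu> v $ j $ i"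
  by (simp add: form_II_component pdiff2_commute[of v i j])

section \<open>Derivatives of the normal and of the fundamental forms\<close>

lemma \<nu>_inner_pdiff_\<nu>:
  assumes "v \<in> U"
  shows "\<nu> v \<bullet> pdiff i \<nu> v = 0"
proof -
  have "(\<lambda>v. \<nu> v \<bullet> \<nu> v) differentiable (at v)"
    by (intro differentiable_inner \<nu>_differentiable assms)
  then have "pdiff i (\<lambda>v. \<nu> v \<bullet> \<nu> v) v = pdiff i (\<lambda>v. 1) v"
    by (rule pdiff_cong[OF _ open_U assms]) (simp add: norm_\<nu> dot_square_norm)
  then show ?thesis
    by (simp add: pdiff_inner \<nu>_differentiable assms pdiff_const inner_commute)
qed

text \<open>Differentiate the identity saying that \<open>\<nu>\<close> is orthogonal to
  \<open>pdiff j r\<close>.\<close>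

lemma weingarten:
  assumes "v \<in> U"
  shows "pdiff i \<nu> v \<bullet> pdiff j r v = - form_II r \<nu> v $ i $ j"
proof -
  have "pdiff i (\<lambda>v. \<nu> v \<bullet> pdiff j r v) v = pdiff i (\<lambda>v. 0) v"
    by (rule pdiff_cong[OF _ open_U assms])
      (simp_all add: differentiable_inner \<nu>_differentiable r_differentiable assms \<nu>_tangent)
  then show ?thesis
    by (simp add: pdiff_inner \<nu>_differentiable r_differentiable assms pdiff_const
        form_II_component inner_commute pdiff2_commute[of v i j])
qed

lemma pdiff_form_I:
  assumes "v \<in> U"
  shows "(\<lambda>v. form_I r v $ i $ j) differentiable (at v)"
    and "pdiff m (\<lambda>v. form_I r v $ i $ j) v =
      pdiff m (pdiff i r) v \<bullet> pdiff j r v + pdiff m (pdiff j r) v \<bullet> pdiff i r v"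
  unfolding form_I_component
  by (simp_all add: differentiable_inner r_differentiable assms pdiff_inner inner_commute)

lemma pdiff_form_II:
  assumes "v \<in> U"
  shows "(\<lambda>v. form_II r \<nu> v $ i $ j) differentiable (at v)"
    and "pdiff m (\<lambda>v. form_II r \<nu> v $ i $ j) v =
      pdiff m (pdiff i (pdiff j r)) v \<bullet> \<nu> v + pdiff i (pdiff j r) v \<bullet> pdiff m \<nu> v"
  unfolding form_II_component
  by (simp_all add: differentiable_inner r_differentiable \<nu>_differentiable assms pdiff_inner
      pdiff2_commute[of v i j] pdiff3_commute(2)[of v m i j])

lemma cross_pdiff_r_nonzero:
  assumes "v \<in> U"
  shows "pdiff 1 r v \<times> pdiff 2 r v \<noteq> 0"
proof
  assume "pdiff 1 r v \<times> pdiff 2 r v = 0"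
  then have "det (form_I r v) = 0"
    using cross_dot_cross[of "pdiff 1 r v" "pdiff 2 r v" "pdiff 1 r v" "pdiff 2 r v"]
    by (simp add: det_2 form_I_component)
  then show False using det_I[OF assms] by simp
qed

text \<open>By Binet-Cauchy and \<open>weingarten\<close>, the inner product of the cross products
  of the derivatives of \<open>\<nu>\<close> and of \<open>r\<close> is
  \<open>det (form_II r \<nu> v)\<close>; the minus signs cancel in pairs.\<close>

lemma cross_pdiff_\<nu>_nonzero:
  assumes "v \<in> U"
  shows "pdiff 1 \<nu> v \<times> pdiff 2 \<nu> v \<noteq> 0"
proof
  assume "pdiff 1 \<nu> v \<times> pdiff 2 \<nu> v = 0"
  then have "det (form_II r \<nu> v) = 0"
    using cross_dot_cross[of "pdiff 1 \<nu> v" "pdiff 2 \<nu> v" "pdiff 1 r v" "pdiff 2 r v"]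
    by (simp add: det_2 weingarten assms)
  then show False using det_II[OF assms] by simp
qed

lemma det_III:
  assumes "v \<in> U"
  shows "det (form_III \<nu> v) \<noteq> 0"
proof -
  have "det (form_III \<nu> v) =
      (pdiff 1 \<nu> v \<times> pdiff 2 \<nu> v) \<bullet> (pdiff 1 \<nu> v \<times> pdiff 2 \<nu> v)"
    by (simp add: det_2 form_III_component cross_dot_cross)
  then show ?thesis using cross_pdiff_\<nu>_nonzero[OF assms] by simp
qed

text \<open>The Weingarten equations multiplied by the inverse of the second form. The difference
  \<open>w\<close> of the sides is tested on the frame \<open>pdiff 1 r\<close>,
  \<open>pdiff 2 r\<close>, \<open>\<nu>\<close>: against \<open>pdiff k r\<close> each side gives
  minus a Kronecker delta, against \<open>\<nu>\<close> each gives 0.\<close>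

lemma weingarten_inv:
  assumes "v \<in> U"
  shows "(\<Sum>i\<in>UNIV. matrix_inv (form_II r \<nu> v) $ j $ i *\<^sub>R pdiff i \<nu> v) =
    - (\<Sum>l\<in>UNIV. matrix_inv (form_I r v) $ j $ l *\<^sub>R pdiff l r v)"
proof -
  define w where "w = (\<Sum>i\<in>UNIV. matrix_inv (form_II r \<nu> v) $ j $ i *\<^sub>R pdiff i \<nu> v) +
    (\<Sum>l\<in>UNIV. matrix_inv (form_I r v) $ j $ l *\<^sub>R pdiff l r v)"
  have "w \<bullet> pdiff k r v = 0" for k
    using matrix_inv_mult(2)[OF det_I[OF assms], of j k]
      matrix_inv_mult(2)[OF det_II[OF assms], of j k]
    by (simp add: w_def inner_add_left inner_sum_left weingarten[OF assms] sum_negf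
        form_I_component[symmetric])
  moreover have "w \<bullet> \<nu> v = 0"
    using \<nu>_inner_pdiff_\<nu>[OF assms] \<nu>_tangent[OF assms]
    by (simp add: w_def inner_add_right inner_sum_right inner_commute[of _ "\<nu> v"])
  ultimately have "w = 0"
    using eq_0_if_orthogonal_to_frame[OF cross_pdiff_r_nonzero[OF assms], of "\<nu> v" w]
      \<nu>_tangent[OF assms] norm_\<nu>[OF assms] by force
  then show ?thesis by (simp add: w_def eq_neg_iff_add_eq_0)
qed

lemma pdiff_gauss_curvature:
  assumes "v \<in> U"
  shows "pdiff m (gauss_curvature r \<nu>) v = gauss_curvature r \<nu> v *
    ((\<Sum>i\<in>UNIV. \<Sum>j\<in>UNIV. matrix_inv (form_II r \<nu> v) $ i $ j * pdiff m (\<lambda>v. form_II r \<nu> v $ i $ j) v)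
     - (\<Sum>i\<in>UNIV. \<Sum>j\<in>UNIV. matrix_inv (form_I r v) $ i $ j * pdiff m (\<lambda>v. form_I r v $ i $ j) v))"
proof -
  let ?K = "gauss_curvature r \<nu>"
  note dI = pdiff_det[OF det_I[OF assms] pdiff_form_I(1)[OF assms]]
  note dII = pdiff_det[OF det_II[OF assms] pdiff_form_II(1)[OF assms]]
  have K: "?K differentiable (at v)"
    unfolding gauss_curvature_def[abs_def]
    by (intro differentiable_divide dI dII det_I assms)
  \<comment> \<open>Differentiating \<open>det II = K * det I\<close> as a product avoids the
    quotient rule; Jacobi's formula then applies to both determinants.\<close>
  have "pdiff m (\<lambda>v. det (form_II r \<nu> v)) v = pdiff m (\<lambda>v. ?K v * det (form_I r v)) v"
    by (rule pdiff_cong[OF dII(1) open_U assms]) (simp add: gauss_curvature_def det_I)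
  then have "pdiff m ?K v * det (form_I r v) =
      pdiff m (\<lambda>v. det (form_II r \<nu> v)) v - ?K v * pdiff m (\<lambda>v. det (form_I r v)) v"
    by (simp add: pdiff_mult K dI(1))
  moreover have "det (form_II r \<nu> v) = ?K v * det (form_I r v)"
    using det_I[OF assms] by (simp add: gauss_curvature_def)
  ultimately have "pdiff m ?K v * det (form_I r v) = ?K v *
    ((\<Sum>i\<in>UNIV. \<Sum>j\<in>UNIV. matrix_inv (form_II r \<nu> v) $ j $ i * pdiff m (\<lambda>v. form_II r \<nu> v $ i $ j) v)
     - (\<Sum>i\<in>UNIV. \<Sum>j\<in>UNIV. matrix_inv (form_I r v) $ j $ i * pdiff m (\<lambda>v. form_I r v $ i $ j) v))
      * det (form_I r v)"
    unfolding dI(2) dII(2) by (simp add: algebra_simps)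
  \<comment> \<open>Jacobi's formula carries transposed inverses; symmetry of the forms restores the
    index order.\<close>
  then show ?thesis
    using det_I[OF assms] matrix_inv_sym_2[OF det_I[OF assms] form_I_sym]
      matrix_inv_sym_2[OF det_II[OF assms] form_II_sym[OF assms]] by (simp add: sum_2)
qed

section \<open>Inner products of the Beltrami parameters with the frame\<close>

lemma beltrami2_inner_pdiff_\<nu>:
  assumes "v \<in> U"
  shows "gauss_curvature r \<nu> v * (beltrami2_vec (form_II r \<nu>) r v \<bullet> pdiff m \<nu> v) =
    - (1 / 2) * pdiff m (gauss_curvature r \<nu>) v"
proof -
  let ?B = "matrix_inv (form_II r \<nu> v)" and ?G = "matrix_inv (form_I r v)"
  let ?Q = "\<lambda>i j k. pdiff i (pdiff j r) v \<bullet> pdiff k \<nu> v"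
  let ?dB = "\<lambda>i j. pdiff m (\<lambda>v. form_II r \<nu> v $ i $ j) v"
  let ?dG = "\<lambda>i j. pdiff m (\<lambda>v. form_I r v $ i $ j) v"
  have B_sym: "?B $ i $ j = ?B $ j $ i" for i j
    using matrix_inv_sym_2[OF det_II[OF assms] form_II_sym[OF assms]] exhaust_2[of i] exhaust_2[of j]
    by auto
  have G_sym: "?G $ i $ j = ?G $ j $ i" for i j
    using matrix_inv_sym_2[OF det_I[OF assms] form_I_sym] exhaust_2[of i] exhaust_2[of j]
    by auto
  \<comment> \<open>By \<open>weingarten\<close> the Christoffel term becomes half of a signed sum
    of three derivatives of the second form. Each contains the same third-derivative term, so one
    half of it survives and joins half of \<open>?Q i j m\<close> to form half of
    \<open>?dB i j\<close>.\<close>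
  have summand: "(pdiff i (pdiff j r) v - (\<Sum>k\<in>UNIV. christoffel (form_II r \<nu>) k i j v *\<^sub>R pdiff k r v))
      \<bullet> pdiff m \<nu> v = (1 / 2) * ?dB i j + (1 / 2) * (?Q m j i + ?Q m i j)" for i j
  proof -
    have "(\<Sum>k\<in>UNIV. christoffel (form_II r \<nu>) k i j v *\<^sub>R pdiff k r v) \<bullet> pdiff m \<nu> v =
        - (\<Sum>k\<in>UNIV. form_II r \<nu> v $ m $ k * christoffel (form_II r \<nu>) k i j v)"
      using weingarten[OF assms, of m]
      by (simp add: inner_sum_right inner_commute[of _ "pdiff m \<nu> v"] sum_negf mult.commute)
    then show ?thesis
      unfolding christoffel_lowered[of "form_II r \<nu>", OF det_II[OF assms]] pdiff_form_II(2)[OF assms]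
      using pdiff3_commute[OF assms] pdiff2_commute[OF assms]
      by (simp add: inner_diff_left field_simps)
  qed
  have "(\<Sum>i\<in>UNIV. \<Sum>j\<in>UNIV. ?B $ i $ j * ?Q m j i) =
      (\<Sum>j\<in>UNIV. pdiff m (pdiff j r) v \<bullet> (\<Sum>i\<in>UNIV. ?B $ j $ i *\<^sub>R pdiff i \<nu> v))"
    by (subst sum.swap) (simp add: inner_sum_right B_sym)
  \<comment> \<open>\<open>weingarten_inv\<close> trades the derivatives of \<open>\<nu>\<close> for
    derivatives of \<open>r\<close>; this is where the first form enters.\<close>
  also have "\<dots> = - (\<Sum>j\<in>UNIV. \<Sum>l\<in>UNIV. ?G $ j $ l * (pdiff m (pdiff j r) v \<bullet> pdiff l r v))"
    unfolding weingarten_inv[OF assms] by (simp add: inner_sum_right sum_negf)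
  \<comment> \<open>The two terms of the derivative of the first form contribute equally, as
    \<open>?G\<close> is symmetric; hence the factor one half.\<close>
  also have "\<dots> = - (1 / 2) * (\<Sum>i\<in>UNIV. \<Sum>j\<in>UNIV. ?G $ i $ j * ?dG i j)"
    unfolding pdiff_form_I(2)[OF assms] using G_sym[of 1 2] by (simp add: sum_2 algebra_simps)
  finally have Q: "(\<Sum>i\<in>UNIV. \<Sum>j\<in>UNIV. ?B $ i $ j * ?Q m j i) =
    - (1 / 2) * (\<Sum>i\<in>UNIV. \<Sum>j\<in>UNIV. ?G $ i $ j * ?dG i j)" .
  have "beltrami2_vec (form_II r \<nu>) r v \<bullet> pdiff m \<nu> v =
      - (\<Sum>i\<in>UNIV. \<Sum>j\<in>UNIV. ?B $ i $ j * ((1 / 2) * ?dB i j + (1 / 2) * (?Q m j i + ?Q m i j)))"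
    unfolding beltrami2_vec_eq[OF r_C_diff(1) open_U assms] inner_minus_left inner_sum_left
      inner_scaleR_left summand ..
  \<comment> \<open>The two mixed \<open>?Q\<close> sums coincide by symmetry of \<open>?B\<close>,
    which absorbs their factor one half.\<close>
  also have "\<dots> = - (1 / 2) * (\<Sum>i\<in>UNIV. \<Sum>j\<in>UNIV. ?B $ i $ j * ?dB i j)
      - (\<Sum>i\<in>UNIV. \<Sum>j\<in>UNIV. ?B $ i $ j * ?Q m j i)"
    using B_sym[of 1 2] by (simp add: sum_2 algebra_simps)
  finally have "beltrami2_vec (form_II r \<nu>) r v \<bullet> pdiff m \<nu> v =
      - (1 / 2) * (\<Sum>i\<in>UNIV. \<Sum>j\<in>UNIV. ?B $ i $ j * ?dB i j)
      + (1 / 2) * (\<Sum>i\<in>UNIV. \<Sum>j\<in>UNIV. ?G $ i $ j * ?dG i j)"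
    unfolding Q by simp
  then show ?thesis
    unfolding pdiff_gauss_curvature[OF assms] by (simp only: algebra_simps)
qed

text \<open>The Christoffel terms are tangential and drop out, so the trace of the identity matrix
  remains.\<close>

lemma beltrami2_inner_\<nu>:
  assumes "v \<in> U"
  shows "beltrami2_vec (form_II r \<nu>) r v \<bullet> \<nu> v = - 2"
proof -
  have "(pdiff i (pdiff j r) v - (\<Sum>k\<in>UNIV. christoffel (form_II r \<nu>) k i j v *\<^sub>R pdiff k r v))
      \<bullet> \<nu> v = form_II r \<nu> v $ j $ i" for i j
    using \<nu>_tangent[OF assms]
    by (simp add: form_II_component inner_diff_right inner_sum_right inner_commute[of _ "\<nu> v"])
  then show ?thesis
    unfolding beltrami2_vec_eq[OF r_C_diff(1) open_U assms]
    by (simp add: inner_sum_left matrix_inv_mult(2)[OF det_II[OF assms]])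
qed

text \<open>The third form is the Gram matrix of the derivatives of \<open>\<nu>\<close>, so its
  inverse cancels in the first product. The second vanishes because these derivatives are orthogonal
  to \<open>\<nu>\<close>.\<close>

lemma beltrami1_inner:
  assumes "v \<in> U"
  shows "beltrami1_vec (form_III \<nu>) \<phi> \<nu> v \<bullet> pdiff m \<nu> v = pdiff m \<phi> v"
    and "beltrami1_vec (form_III \<nu>) \<phi> \<nu> v \<bullet> \<nu> v = 0"
proof -
  have "beltrami1_vec (form_III \<nu>) \<phi> \<nu> v \<bullet> pdiff m \<nu> v =
      (\<Sum>i\<in>UNIV. pdiff i \<phi> v *
        (\<Sum>j\<in>UNIV. matrix_inv (form_III \<nu> v) $ i $ j * form_III \<nu> v $ j $ m))"
    by (simp add: beltrami1_vec_eq \<nu>_differentiable assms inner_sum_left form_III_component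
        sum_distrib_left mult_ac)
  also have "\<dots> = pdiff m \<phi> v"
    by (simp add: matrix_inv_mult(2)[OF det_III[OF assms]] if_distrib[of "\<lambda>x. _ * x"] cong: if_cong)
  finally show "beltrami1_vec (form_III \<nu>) \<phi> \<nu> v \<bullet> pdiff m \<nu> v = pdiff m \<phi> v" .
  show "beltrami1_vec (form_III \<nu>) \<phi> \<nu> v \<bullet> \<nu> v = 0"
    using \<nu>_inner_pdiff_\<nu>[OF assms]
    by (simp add: beltrami1_vec_eq \<nu>_differentiable assms inner_sum_right
        inner_commute[of _ "\<nu> v"])
qed

lemma beltrami2_II_position:
  assumes "v \<in> U"
  shows "beltrami2_vec (form_II r \<nu>) r v =
    - (1 / (2 * gauss_curvature r \<nu> v)) *\<^sub>R
        beltrami1_vec (form_III \<nu>) (gauss_curvature r \<nu>) \<nu> v - 2 *\<^sub>R \<nu> v"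
proof -
  let ?K = "gauss_curvature r \<nu>"
  define w where "w = beltrami2_vec (form_II r \<nu>) r v +
    (1 / (2 * ?K v)) *\<^sub>R beltrami1_vec (form_III \<nu>) ?K \<nu> v + 2 *\<^sub>R \<nu> v"
  have K: "?K v \<noteq> 0"
    using det_I[OF assms] det_II[OF assms] by (simp add: gauss_curvature_def)
  have "w \<bullet> pdiff m \<nu> v = 0" for m
    using beltrami2_inner_pdiff_\<nu>[OF assms, of m] K \<nu>_inner_pdiff_\<nu>[OF assms]
    by (simp add: w_def inner_add_left beltrami1_inner assms field_simps)
  moreover have "w \<bullet> \<nu> v = 0"
    using norm_\<nu>[OF assms]
    by (simp add: w_def inner_add_left beltrami1_inner beltrami2_inner_\<nu> assms dot_square_norm)
  ultimately have "w = 0"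
    using eq_0_if_orthogonal_to_frame[OF cross_pdiff_\<nu>_nonzero[OF assms], of "\<nu> v" w]
      \<nu>_inner_pdiff_\<nu>[OF assms] norm_\<nu>[OF assms] by force
  then have "beltrami2_vec (form_II r \<nu>) r v =
      - ((1 / (2 * ?K v)) *\<^sub>R beltrami1_vec (form_III \<nu>) ?K \<nu> v + 2 *\<^sub>R \<nu> v)"
    unfolding w_def add.assoc by (simp only: eq_neg_iff_add_eq_0)
  then show ?thesis by simp
qed

end


section \<open>Surfaces\<close>

lemma differentiable_cross:
  assumes "f differentiable (at u)" "g differentiable (at u)"
  shows "(\<lambda>v. f v \<times> g v) differentiable (at u)"
  using assms bounded_bilinear.FDERIV[OF bilinear_cross[unfolded bilinear_conv_bounded_bilinear]]
  unfolding differentiable_def by blast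

text \<open>There are only two unit normals, and continuity fixes locally which one
  \<open>\<nu>\<close> is; the normalized cross product of \<open>a\<close> and \<open>b\<close> is
  differentiable.\<close>

lemma unit_normal_differentiable:
  fixes a b \<nu> :: "real^2 \<Rightarrow> real^3"
  assumes U: "open U" "u \<in> U"
    and ab: "a differentiable (at u)" "b differentiable (at u)" "a u \<times> b u \<noteq> 0"
    and ab_cont: "continuous_on U a" "continuous_on U b"
    and \<nu>: "continuous_on U \<nu>" "\<And>v. v \<in> U \<Longrightarrow> norm (\<nu> v) = 1"
      "\<And>v. v \<in> U \<Longrightarrow> \<nu> v \<bullet> a v = 0" "\<And>v. v \<in> U \<Longrightarrow> \<nu> v \<bullet> b v = 0"
  shows "\<nu> differentiable (at u)"
proof -
  define N where "N v = a v \<times> b v" for v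
  define c where "c v = \<nu> v \<bullet> N v" for v
  have N_eq: "c v *\<^sub>R \<nu> v = N v" if "v \<in> U" for v
  proof -
    have "\<nu> v \<times> N v = 0" using \<nu>(3,4)[OF that] by (simp add: N_def Lagrange)
    then show ?thesis
      using Lagrange[of "\<nu> v" "\<nu> v" "N v"] \<nu>(2)[OF that] by (simp add: c_def dot_square_norm)
  qed
  then have abs_c: "\<bar>c v\<bar> = norm (N v)" if "v \<in> U" for v
    using that \<nu>(2) by (metis mult.right_neutral norm_scaleR)
  have c_cont: "continuous_on U (\<lambda>v. c u * c v)"
    unfolding c_def N_def by (intro continuous_intros continuous_on_cross ab_cont \<nu>(1))
  have N_u: "N u \<noteq> 0" using ab(3) by (simp add: N_def)
  \<comment> \<open>On the open set where \<open>c\<close> keeps its sign, \<open>\<nu> = \<plusminus> N / \<parallel>N\<parallel>\<close> with a constant sign.\<close>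
  define W where "W = {v \<in> U. 0 < c u * c v}"
  have "open W"
    using continuous_open_preimage[OF c_cont U(1), of "{0<..}"] by (simp add: W_def vimage_def Int_def)
  moreover have "u \<in> W" using U(2) abs_c[OF U(2)] N_u by (auto simp: W_def zero_less_mult_iff)
  moreover have "(1 / (sgn (c u) * norm (N v))) *\<^sub>R N v = \<nu> v" if "v \<in> W" for v
  proof -
    have v: "v \<in> U" "0 < c u * c v" using that by (auto simp: W_def)
    then have "sgn (c u) * norm (N v) = c v"
      using abs_c[OF v(1)] by (auto simp: sgn_if zero_less_mult_iff)
    then show ?thesis using N_eq[OF v(1)] v(2)
      by (metis divide_self_if mult_zero_right less_irrefl scaleR_one scaleR_scaleR times_divide_eq_left mult_1)
  qed
  moreover have "(\<lambda>v. (1 / (sgn (c u) * norm (N v))) *\<^sub>R N v) differentiable (at u)"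
  proof -
    have N: "N differentiable (at u)"
      unfolding N_def[abs_def] by (intro differentiable_cross ab)
    have "(\<lambda>v. norm (N v)) differentiable (at u)"
      using differentiable_compose[OF differentiable_norm_at[OF N_u] N] .
    then show ?thesis
      using N N_u abs_c[OF U(2)]
      by (intro differentiable_scaleR differentiable_divide differentiable_mult)
        (auto simp: sgn_if)
  qed
  ultimately show ?thesis
    using has_derivative_transform_within_open unfolding differentiable_def by blast
qed

text \<open>If the cross product of the images \<open>?a\<close>, \<open>?b\<close> of the axes
  vanishes, the triple product expansion gives a kernel vector with first coordinate
  \<open>?b \<bullet> ?b\<close>. Injectivity makes this 0, so \<open>?b = 0\<close> and the second
  axis lies in the kernel, a contradiction.\<close>

lemma inj_derivative_cross_nonzero:
  fixes f :: "real^2 \<Rightarrow> real^3"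
  assumes f: "f differentiable (at u)" and inj: "inj (frechet_derivative f (at u))"
  shows "pdiff 1 f u \<times> pdiff 2 f u \<noteq> 0"
proof
  let ?D = "frechet_derivative f (at u)"
  assume 0: "pdiff 1 f u \<times> pdiff 2 f u = 0"
  have D: "(f has_derivative ?D) (at u)" using f frechet_derivative_works by blast
  have lin: "linear ?D" using has_derivative_linear[OF D] .
  have D0: "w = 0" if "?D w = 0" for w
    using that inj linear_injective_0[OF lin] by blast
  let ?a = "?D (axis 1 1)" and ?b = "?D (axis 2 1)"
  have "?b \<times> (?a \<times> ?b) = 0" using 0 by (simp add: pdiff_eq[OF D])
  then have "?D ((?b \<bullet> ?b) *\<^sub>R axis 1 1 - (?b \<bullet> ?a) *\<^sub>R axis 2 1) = 0"
    by (simp add: Lagrange linear_diff[OF lin] linear_scale[OF lin])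
  from D0[OF this] have "?b \<bullet> ?b = 0"
    by (auto simp: vec_eq_iff forall_2 axis_def)
  then have "axis 2 (1::real) = (0 :: real^2)" by (intro D0) simp
  then show False by (simp add: axis_eq_0_iff)
qed

theorem mainTheorem6:
  fixes M :: "'m::t2_space set" and x n :: "'m \<Rightarrow> real^3"
    and U :: "(real^2) set" and p :: "real^2 \<Rightarrow> 'm" and u :: "real^2"
  assumes "surface M x" and "connected M"
    and "unit_normal M x n"
    and "\<forall>m\<in>M. elliptic_point M x n m"
    and "local_coords M x U p" and "u \<in> U"
  shows "beltrami2_vec (form_II (x \<circ> p) (n \<circ> p)) (x \<circ> p) u =
      - (1 / (2 * gauss_curvature (x \<circ> p) (n \<circ> p) u)) *\<^sub>R
          beltrami1_vec (form_III (n \<circ> p)) (gauss_curvature (x \<circ> p) (n \<circ> p)) (n \<circ> p) u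
      - 2 *\<^sub>R n (p u)"
proof -
  note n = assms(3) and elliptic = assms(4) and coords = assms(5)
  let ?r = "x \<circ> p" and ?\<nu> = "n \<circ> p"
  have U: "open U" and C3: "C_diff 3 ?r U"
    and inj: "\<And>v. v \<in> U \<Longrightarrow> inj (frechet_derivative ?r (at v))"
    and pU: "p ` U \<subseteq> M" and p: "continuous_on U p"
    using coords openin_imp_subset unfolding local_coords_def homeomorphism_def by blast+
  have "C_diff (Suc (Suc (Suc 0))) ?r U" using C3 by (simp only: numeral_3_eq_3)
  then have C1: "C_diff (Suc (Suc 0)) ?r U" by (rule C_diff_Suc_imp)
  then have C2: "C_diff (Suc 0) (pdiff i ?r) U" for i by simp
  have cross: "pdiff 1 ?r v \<times> pdiff 2 ?r v \<noteq> 0" if "v \<in> U" for v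
    using inj_derivative_cross_nonzero[OF C_diff_Suc_at[OF C1 U that] inj[OF that]] .
  have tangent: "?\<nu> v \<bullet> pdiff i ?r v = 0" if "v \<in> U" for v i
    using n coords that unfolding unit_normal_def by simp
  have norm: "norm (?\<nu> v) = 1" if "v \<in> U" for v
    using n pU that unfolding unit_normal_def by auto
  have "continuous_on (p ` U) n"
    using n pU continuous_on_subset unfolding unit_normal_def by blast
  then have cont: "continuous_on U ?\<nu>"
    using continuous_on_compose[OF p] by blast
  have \<nu>: "?\<nu> differentiable (at v)" if "v \<in> U" for v
    by (rule unit_normal_differentiable[of U v "pdiff 1 ?r" "pdiff 2 ?r", OF U that _ _ cross[OF that]])
      (simp_all add: C_diff_Suc_at[OF C2 U that] C_diff_continuous_on[OF C2] cont norm tangent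
        del: o_apply)
  have I: "det (form_I ?r v) \<noteq> 0" if "v \<in> U" for v
  proof -
    have "det (form_I ?r v) =
        (pdiff 1 ?r v \<times> pdiff 2 ?r v) \<bullet> (pdiff 1 ?r v \<times> pdiff 2 ?r v)"
      by (simp add: det_2 form_I_def cross_dot_cross)
    then show ?thesis using cross[OF that] by simp
  qed
  \<comment> \<open>Ellipticity gives nondegeneracy: a vanishing numerator would make the Gauss
    curvature 0.\<close>
  have II: "det (form_II ?r ?\<nu> v) \<noteq> 0" if "v \<in> U" for v
  proof -
    have "gauss_curvature ?r ?\<nu> v > 0"
      using elliptic coords pU that unfolding elliptic_point_def by blast
    then show ?thesis by (auto simp: gauss_curvature_def)
  qed
  show ?thesis
    using beltrami2_II_position[OF U C3 \<nu> norm tangent I II assms(6)] by simp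
qed

end
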